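(* Let $\pi$ be a fixed nonzero exact vincular pattern whose largest block has size $s$ and whose longest block has length $\ell$. Then, as $n\to\infty$, $$\mathbb{P}\big[\mathbf{C}_{n,p}\text{ contains }\pi\big]\to\begin{cases}0,&\text{if } p\ll n^{-1/s},\\ 1,&\text{if } n^{-1/s}\ll p\text{ and } q\gg n^{-1/\ell},\\ 0,&\text{if } n^{-1/\ell}\gg q.\end{cases}$$
   Context: An $n$-composition is a sequence of $n$ nonnegative integers. For $p=p(n)\in[0,1)$ and $q=1-p$, the geometric random composition $\mathbf{C}_{n,p}$ is the random $n$-composition whose terms are independent, with $\mathbb{P}[\mathbf{C}_{n,p}(i)=j]=qp^j$ for every $j\ge0$ and $i\in\{1,\dots,n\}$. An exact vincular pattern is a sequence $\pi=r_1\ldots r_k$ of nonnegative integers partitioned into consecutive nonempty blocks; it is nonzero if some $r_j$ is positive. A composition $C$ contains $\pi$ if there exist indices $i_1<i_2<\dots<i_k$ such that $C(i_j)=r_j$ for every $j$, and $i_{j+1}=i_j+1$ whenever positions $j$ and $j+1$ of $\pi$ lie in the same block (terms of different blocks need not be adjacent, but may be). The length of a block is its number of terms and its size is the sum of its terms; the largest block is one of maximum size and the longest block is one of maximum length. For positive functions of $n$: $f\ll g$ (or $g\gg f$) means $\lim_{n\to\infty} f/g=0$. *)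

theory Defs
  imports "HOL-Probability.Probability"
begin

(* A pattern r_1 ... r_k together with its partition into consecutive blocks is given as
   the list of its blocks; the underlying sequence is the concatenation of the blocks,
   with positions counted from 0. *)
type_synonym vincular_pattern = "nat list list"

definition exact_vincular_pattern :: "vincular_pattern \<Rightarrow> bool" where
  "exact_vincular_pattern \<pi> \<longleftrightarrow> (\<forall>b \<in> set \<pi>. b \<noteq> [])"

definition nonzero_pattern :: "vincular_pattern \<Rightarrow> bool" where
  "nonzero_pattern \<pi> \<longleftrightarrow> (\<exists>r \<in> set (concat \<pi>). 0 < r)"

definition block_positions :: "vincular_pattern \<Rightarrow> nat \<Rightarrow> nat set" where
  "block_positions \<pi> b = {length (concat (take b \<pi>)) ..< length (concat (take (Suc b) \<pi>))}"

definition same_block :: "vincular_pattern \<Rightarrow> nat \<Rightarrow> nat \<Rightarrow> bool" where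
  "same_block \<pi> j j' \<longleftrightarrow>
     (\<exists>b < length \<pi>. j \<in> block_positions \<pi> b \<and> j' \<in> block_positions \<pi> b)"

definition largest_block_size :: "vincular_pattern \<Rightarrow> nat" where
  "largest_block_size \<pi> = Max (sum_list ` set \<pi>)"

definition longest_block_length :: "vincular_pattern \<Rightarrow> nat" where
  "longest_block_length \<pi> = Max (length ` set \<pi>)"

(* An n-composition is a function C of which only the values on {1..n} matter. *)
definition contains :: "nat \<Rightarrow> (nat \<Rightarrow> nat) \<Rightarrow> vincular_pattern \<Rightarrow> bool" where
  "contains n C \<pi> \<longleftrightarrow>
     (\<exists>i :: nat \<Rightarrow> nat.
        strict_mono_on {..<length (concat \<pi>)} i \<and>
        (\<forall>j < length (concat \<pi>). i j \<in> {1..n} \<and> C (i j) = concat \<pi> ! j) \<and>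
        (\<forall>j. Suc j < length (concat \<pi>) \<longrightarrow> same_block \<pi> j (Suc j) \<longrightarrow> i (Suc j) = i j + 1))"

(* The parameter of geometric_pmf is the probability of the value 0, which here is q = 1 - p. *)
definition geometric_random_composition :: "nat \<Rightarrow> real \<Rightarrow> (nat \<Rightarrow> nat) pmf" where
  "geometric_random_composition n p = Pi_pmf {1..n} 0 (\<lambda>_. geometric_pmf (1 - p))"

lemma geometric_random_composition_term:
  assumes "0 \<le> p" "p < 1" "i \<in> {1..n}"
  shows "measure_pmf.prob (geometric_random_composition n p) {C. C i = j} = (1 - p) * p ^ j"
proof -
  have "measure_pmf.prob (geometric_random_composition n p) {C. C i = j}
      = pmf (map_pmf (\<lambda>C. C i) (geometric_random_composition n p)) j"
    by (simp add: pmf_map vimage_def)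
  also have "\<dots> = pmf (geometric_pmf (1 - p)) j"
    using assms by (simp add: geometric_random_composition_def Pi_pmf_component)
  finally show ?thesis using assms by simp
qed

lemma geometric_random_composition_indep:
  "prob_space.indep_vars (measure_pmf (geometric_random_composition n p))
     (\<lambda>_. count_space UNIV) (\<lambda>i C. C i) {1..n}"
  unfolding geometric_random_composition_def by (rule indep_vars_Pi_pmf) simp

(* The positivity of g is not redundant: division by zero yields 0, so without it the limit
   would also hold for g = 0. *)
definition much_less :: "(nat \<Rightarrow> real) \<Rightarrow> (nat \<Rightarrow> real) \<Rightarrow> bool" where
  "much_less f g \<longleftrightarrow> (\<forall>\<^sub>F n in sequentially. 0 < g n) \<and> (\<lambda>n. f n / g n) \<longlonglongrightarrow> 0"

end

theory Submission
  imports Defs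
begin

text \<open>
  A block of length \<open>L\<close> and size \<open>S\<close> fills a prescribed run of positions with probability
  \<open>q\<^sup>L p\<^sup>S\<close>, so in the whole composition it is expected about \<open>n q\<^sup>L p\<^sup>S\<close> times. As \<open>p\<close>
  and \<open>q\<close> lie in \<open>[0, 1]\<close>, this is at most \<open>n p\<^sup>s\<close> for the largest block and at most
  \<open>n q\<^sup>l\<close> for the longest one. If \<open>p\<close> is far below \<open>n\<close> to the power \<open>-1/s\<close>, or \<open>q\<close> far
  below \<open>n\<close> to the power \<open>-1/l\<close>, the corresponding bound tends to \<open>0\<close>. A composition that
  contains the pattern contains each of its blocks, so the union bound over positions
  (\<open>prob_contains_le\<close>) gives both limits \<open>0\<close>.

  For the limit \<open>1\<close>, the composition is cut into as many consecutive segments as the pattern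
  has blocks, each segment into \<open>N\<close> disjoint windows of length \<open>l\<close>, where \<open>N\<close> is of order
  \<open>n\<close>. The pattern is contained as soon as, for every \<open>j\<close>, the \<open>j\<close>-th block starts some
  window of the \<open>j\<close>-th segment: the segments put the blocks in the right order, and no
  adjacency is required between different blocks. Disjoint windows are independent
  (\<open>prob_no_occurs_at\<close>), and each block fills the start of a window with probability at least
  \<open>r = q\<^sup>l p\<^sup>s\<close>. Hence a segment fails with probability at most \<open>(1 - r)\<^sup>N\<close>, which is at most
  \<open>exp (- N r)\<close>, and the whole construction fails with probability at most the number of blocks
  times that (\<open>prob_not_contains_le\<close>). It remains that \<open>n q\<^sup>l p\<^sup>s\<close> tends to infinity
  (\<open>expected_occurrences_at_top\<close>). The two hypotheses say that \<open>n p\<^sup>s\<close> and \<open>n q\<^sup>l\<close> tend to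
  infinity separately; since \<open>p + q = 1\<close>, one of the two factors \<open>p\<close>, \<open>q\<close> is always at
  least \<open>1/2\<close>, so the product is, up to a constant, at least the smaller of the two.
\<close>

section \<open>Containment in terms of block occurrences\<close>

definition occurs_at :: "(nat \<Rightarrow> nat) \<Rightarrow> nat \<Rightarrow> nat list \<Rightarrow> bool" where
  "occurs_at C a b \<longleftrightarrow> (\<forall>i < length b. C (a + i) = b ! i)"

lemma length_concat_take_Suc:
  assumes "k < length \<pi>"
  shows "length (concat (take (Suc k) \<pi>)) = length (concat (take k \<pi>)) + length (\<pi> ! k)"
  using assms by (simp add: take_Suc_conv_app_nth)

lemma length_concat_take_le: "length (concat (take k \<pi>)) \<le> length (concat \<pi>)"
  by (metis append_take_drop_id concat_append length_append le_add1)

lemma nth_concat_block: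
  assumes "k < length \<pi>" and "t < length (\<pi> ! k)"
  shows "concat \<pi> ! (length (concat (take k \<pi>)) + t) = \<pi> ! k ! t"
proof -
  have "concat \<pi> = concat (take k \<pi>) @ \<pi> ! k @ concat (drop (Suc k) \<pi>)"
    using assms(1) by (metis concat.simps(2) concat_append id_take_nth_drop)
  then show ?thesis using assms(2) by (simp add: nth_append)
qed

text \<open>
  Within one block the embedding advances by exactly one at each term, so it is determined by the
  position of the first term.
\<close>

lemma contains_imp_occurs_at:
  assumes cont: "contains n C \<pi>" and b: "b \<in> set \<pi>" and "b \<noteq> []"
  obtains a where "a \<in> {1..n}" and "a + length b \<le> n + 1" and "occurs_at C a b"
proof -
  obtain i where i: "\<And>j. j < length (concat \<pi>) \<Longrightarrow> i j \<in> {1..n} \<and> C (i j) = concat \<pi> ! j"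
    and step: "\<And>j. Suc j < length (concat \<pi>) \<Longrightarrow> same_block \<pi> j (Suc j) \<Longrightarrow> i (Suc j) = i j + 1"
    using cont unfolding contains_def by blast
  obtain k where k: "k < length \<pi>" "b = \<pi> ! k"
    using b by (auto simp: in_set_conv_nth)
  define off where "off = length (concat (take k \<pi>))"
  have len: "off + length b \<le> length (concat \<pi>)"
    using length_concat_take_Suc[OF k(1)] length_concat_take_le[of "Suc k" \<pi>] k(2)
    by (simp add: off_def)
  have run: "i (off + t) = i off + t" if "t < length b" for t
    using that
  proof (induction t)
    case (Suc t)
    have "same_block \<pi> (off + t) (Suc (off + t))"
      unfolding same_block_def block_positions_def
      using k Suc.prems length_concat_take_Suc[OF k(1)] by (intro exI[of _ k]) (auto simp: off_def)
    then show ?case using Suc step[of "off + t"] len by simp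
  qed simp
  have val: "C (i off + t) = b ! t \<and> i off + t \<in> {1..n}" if "t < length b" for t
    using i[of "off + t"] run[OF that] that len nth_concat_block[OF k(1), of t] k(2)
    by (simp add: off_def)
  show thesis
  proof
    show "i off \<in> {1..n}" using val[of 0] \<open>b \<noteq> []\<close> by simp
    show "i off + length b \<le> n + 1"
      using val[of "length b - 1"] \<open>b \<noteq> []\<close> by (cases b) auto
    show "occurs_at C (i off) b" using val by (simp add: occurs_at_def)
  qed
qed

lemma contains_mono: "contains m C \<pi> \<Longrightarrow> m \<le> n \<Longrightarrow> contains n C \<pi>"
  unfolding contains_def by (meson atLeastAtMost_iff le_trans)

lemma same_block_append:
  assumes "same_block (\<pi> @ [b]) j j'" and "j < length (concat \<pi>)"
  shows "same_block \<pi> j j'"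
proof -
  obtain k where k: "k < length (\<pi> @ [b])" "j \<in> block_positions (\<pi> @ [b]) k"
    "j' \<in> block_positions (\<pi> @ [b]) k"
    using assms(1) unfolding same_block_def by blast
  have "k \<noteq> length \<pi>" using k(2) assms(2) by (auto simp: block_positions_def)
  then have "k < length \<pi>" using k(1) by simp
  then have "block_positions (\<pi> @ [b]) k = block_positions \<pi> k"
    by (simp add: block_positions_def)
  then show ?thesis using k \<open>k < length \<pi>\<close> unfolding same_block_def by blast
qed

text \<open>
  Conversely, embeddings are built block by block from the left: the new block must start after
  position \<open>m\<close>, by which the rest of the pattern is already embedded.
\<close>

lemma contains_snoc:
  assumes cont: "contains m C \<pi>" and occ: "occurs_at C a b"
    and "m < a" and "a + length b \<le> n + 1"
  shows "contains n C (\<pi> @ [b])"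
proof -
  obtain i where mono: "strict_mono_on {..<length (concat \<pi>)} i"
    and i: "\<And>j. j < length (concat \<pi>) \<Longrightarrow> i j \<in> {1..m} \<and> C (i j) = concat \<pi> ! j"
    and step: "\<And>j. Suc j < length (concat \<pi>) \<Longrightarrow> same_block \<pi> j (Suc j) \<Longrightarrow> i (Suc j) = i j + 1"
    using cont unfolding contains_def by blast
  define L where "L = length (concat \<pi>)"
  define i' where "i' = (\<lambda>j. if j < L then i j else a + (j - L))"
  have "strict_mono_on {..<length (concat (\<pi> @ [b]))} i'"
  proof (rule strict_mono_onI)
    fix r t :: nat assume "r < t"
    show "i' r < i' t"
    proof (cases "t < L")
      case True
      then show ?thesis using \<open>r < t\<close> strict_mono_onD[OF mono, of r t] by (simp add: i'_def L_def)
    next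
      case False
      then show ?thesis using \<open>r < t\<close> i[of r] \<open>m < a\<close> by (auto simp: i'_def L_def)
    qed
  qed
  moreover have "i' j \<in> {1..n} \<and> C (i' j) = concat (\<pi> @ [b]) ! j"
    if "j < length (concat (\<pi> @ [b]))" for j
  proof (cases "j < L")
    case True
    moreover have "m \<le> n" using assms by linarith
    ultimately show ?thesis using i[of j] by (auto simp: i'_def L_def nth_append)
  next
    case False
    then have "j - L < length b" using that by (simp add: L_def)
    then show ?thesis using False occ assms(3,4)
      by (auto simp: i'_def L_def nth_append occurs_at_def)
  qed
  moreover have "i' (Suc j) = i' j + 1"
    if "Suc j < length (concat (\<pi> @ [b]))" and same: "same_block (\<pi> @ [b]) j (Suc j)" for j
  proof (cases "j < L")
    case True
    then have same': "same_block \<pi> j (Suc j)" using same_block_append same by (simp add: L_def)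
    then obtain k where "k < length \<pi>" "Suc j \<in> block_positions \<pi> k"
      unfolding same_block_def by blast
    then have "Suc j < L"
      using length_concat_take_le[of "Suc k" \<pi>] by (simp add: block_positions_def L_def)
    then show ?thesis using True step[of j] same' by (simp add: i'_def L_def)
  qed (simp add: i'_def)
  ultimately show ?thesis unfolding contains_def by blast
qed

text \<open>The number \<open>e j\<close> is the last position before the \<open>j\<close>-th segment.\<close>

lemma contains_if_occurs_in_segments:
  assumes "\<And>j. j < length \<pi> \<Longrightarrow>
      occurs_at C (a j) (\<pi> ! j) \<and> e j < a j \<and> a j + length (\<pi> ! j) \<le> e (Suc j) + 1"
  shows "contains (e (length \<pi>)) C \<pi>"
  using assms
proof (induction \<pi> rule: rev_induct)
  case Nil
  then show ?case by (simp add: contains_def)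
next
  case (snoc b \<pi>)
  have "contains (e (length \<pi>)) C \<pi>"
  proof (rule snoc.IH)
    fix j assume "j < length \<pi>"
    then show "occurs_at C (a j) (\<pi> ! j) \<and> e j < a j \<and> a j + length (\<pi> ! j) \<le> e (Suc j) + 1"
      using snoc.prems[of j] by (simp add: nth_append)
  qed
  then show ?case using snoc.prems[of "length \<pi>"] by (auto intro!: contains_snoc)
qed

section \<open>Probabilities of block occurrences\<close>

lemma prob_occurs_at:
  assumes p: "0 \<le> p" "p < 1" and "{a..<a + length b} \<subseteq> {1..n}"
  shows "measure_pmf.prob (geometric_random_composition n p) {C. occurs_at C a b}
    = (1 - p) ^ length b * p ^ sum_list b"
proof -
  \<comment> \<open>The event is a cylinder: it constrains each position of the window separately.\<close>
  define B where "B = (\<lambda>x. if x \<in> {a..<a + length b} then {b ! (x - a)} else UNIV)"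
  have "{C. occurs_at C a b} = Pi {1..n} B"
  proof (intro equalityI subsetI)
    fix C assume C: "C \<in> Pi {1..n} B"
    have "C (a + i) = b ! i" if "i < length b" for i
    proof -
      have "a + i \<in> {1..n}" using that assms(3) by (intro subsetD[OF assms(3)]) simp
      then have "C (a + i) \<in> B (a + i)" using C by blast
      then show ?thesis using that by (simp add: B_def)
    qed
    then show "C \<in> {C. occurs_at C a b}" by (simp add: occurs_at_def)
  next
    fix C assume C: "C \<in> {C. occurs_at C a b}"
    have "C x \<in> B x" for x
      using C by (cases "x \<in> {a..<a + length b}")
        (auto simp: B_def occurs_at_def dest: spec[of _ "x - a"])
    then show "C \<in> Pi {1..n} B" by simp
  qed
  then have "measure_pmf.prob (geometric_random_composition n p) {C. occurs_at C a b}
      = (\<Prod>x\<in>{1..n}. measure_pmf.prob (geometric_pmf (1 - p)) (B x))"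
    unfolding geometric_random_composition_def by (simp add: measure_Pi_pmf_Pi)
  also have "\<dots> = (\<Prod>x\<in>{a..<a + length b}. measure_pmf.prob (geometric_pmf (1 - p)) (B x))"
    using assms(3) by (intro prod.mono_neutral_right) (auto simp: B_def)
  also have "\<dots> = (\<Prod>i<length b. measure_pmf.prob (geometric_pmf (1 - p)) (B (a + i)))"
    by (rule prod.reindex_bij_witness[of _ "\<lambda>i. a + i" "\<lambda>x. x - a"]) auto
  also have "\<dots> = (\<Prod>i<length b. (1 - p) * p ^ (b ! i))"
    using p by (intro prod.cong) (auto simp: B_def measure_pmf_single mult.commute)
  also have "\<dots> = (1 - p) ^ length b * p ^ sum_list b"
    by (simp add: prod.distrib power_sum sum_list_sum_nth atLeast0LessThan)
  finally show ?thesis .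
qed

text \<open>
  Whether the block occurs in a window depends only on the terms in that window, and families of
  terms with disjoint index sets are independent.
\<close>

lemma prob_no_occurs_at:
  assumes p: "0 \<le> p" "p < 1"
    and inside: "\<And>t. t < N \<Longrightarrow> {a t..<a t + length b} \<subseteq> {1..n}"
    and disj: "disjoint_family_on (\<lambda>t. {a t..<a t + length b}) {..<N}"
  shows "measure_pmf.prob (geometric_random_composition n p) {C. \<forall>t<N. \<not> occurs_at C (a t) b}
    = (1 - (1 - p) ^ length b * p ^ sum_list b) ^ N"
proof (cases "N = 0")
  case False
  define M where "M = measure_pmf (geometric_random_composition n p)"
  interpret M: prob_space M unfolding M_def by (rule measure_pmf.prob_space_axioms)
  define K where "K = (\<lambda>t. {a t..<a t + length b})"
  \<comment> \<open>\<open>X t\<close> is the content of window \<open>t\<close>, a point of the product space \<open>P t\<close>; \<open>W t\<close> consists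
    of the single content that spells the block. The independence rule is applied to its complement.\<close>
  define W where "W = (\<lambda>t. PiE (K t) (\<lambda>x. {b ! (x - a t)}))"
  define P where "P = (\<lambda>t. PiM (K t) (\<lambda>_::nat. count_space (UNIV :: nat set)))"
  define X where "X = (\<lambda>t (C :: nat \<Rightarrow> nat). restrict C (K t))"
  have "M.indep_vars (\<lambda>_. count_space UNIV) (\<lambda>i C. C i) {1..n}"
    unfolding M_def by (rule geometric_random_composition_indep)
  then have ind: "M.indep_vars P X {..<N}"
    unfolding P_def X_def
    by (rule M.indep_vars_restrict) (use inside disj in \<open>auto simp: K_def\<close>)
  have W: "space (P t) - W t \<in> sets (P t)" for t
    unfolding W_def P_def by (intro sets.compl_sets sets_PiM_I_finite) (auto simp: K_def)
  have X_iff: "X t C \<in> W t \<longleftrightarrow> occurs_at C (a t) b" for t C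
  proof -
    have "(\<forall>x. a t \<le> x \<and> x < a t + length b \<longrightarrow> C x = b ! (x - a t))
        \<longleftrightarrow> (\<forall>i < length b. C (a t + i) = b ! i)"
      by (metis add_diff_cancel_left' le_add1 le_add_diff_inverse nat_add_left_cancel_less)
    then show ?thesis by (auto simp: X_def W_def K_def occurs_at_def PiE_iff)
  qed
  have X_vimage: "X t -` (space (P t) - W t) \<inter> space M = {C. \<not> occurs_at C (a t) b}" for t
    using X_iff by (auto simp: M_def P_def space_PiM X_def)
  have "M.prob (\<Inter>t\<in>{..<N}. X t -` (space (P t) - W t) \<inter> space M)
      = (\<Prod>t\<in>{..<N}. M.prob (X t -` (space (P t) - W t) \<inter> space M))"
    using False W by (intro M.indep_varsD[OF ind]) auto
  moreover have "(\<Inter>t\<in>{..<N}. X t -` (space (P t) - W t) \<inter> space M)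
      = {C. \<forall>t<N. \<not> occurs_at C (a t) b}"
    using X_vimage by auto
  moreover have "M.prob (X t -` (space (P t) - W t) \<inter> space M)
      = 1 - (1 - p) ^ length b * p ^ sum_list b" if "t < N" for t
  proof -
    have "M.prob (space M - {C. occurs_at C (a t) b}) = 1 - M.prob {C. occurs_at C (a t) b}"
      by (rule M.prob_compl) (simp add: M_def)
    moreover have "space M - {C. occurs_at C (a t) b} = {C. \<not> occurs_at C (a t) b}"
      by (auto simp: M_def)
    ultimately show ?thesis
      using prob_occurs_at[OF p inside[OF that]] unfolding X_vimage by (simp add: M_def)
  qed
  ultimately show ?thesis by (simp add: M_def)
qed simp

text \<open>
  The union bound over the possible starting positions of one chosen block.
\<close>

lemma prob_contains_le:
  assumes p: "0 \<le> p" "p < 1" and b: "b \<in> set \<pi>" "b \<noteq> []"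
  shows "measure_pmf.prob (geometric_random_composition n p) {C. contains n C \<pi>}
    \<le> real n * ((1 - p) ^ length b * p ^ sum_list b)"
proof -
  let ?pr = "measure_pmf.prob (geometric_random_composition n p)"
  define A where "A = {a \<in> {1..n}. a + length b \<le> n + 1}"
  have "finite A" by (simp add: A_def)
  have "{C. contains n C \<pi>} \<subseteq> (\<Union>a\<in>A. {C. occurs_at C a b})"
    using contains_imp_occurs_at[OF _ b] unfolding A_def by blast
  then have "?pr {C. contains n C \<pi>} \<le> ?pr (\<Union>a\<in>A. {C. occurs_at C a b})"
    by (intro measure_pmf.finite_measure_mono) auto
  also have "\<dots> \<le> (\<Sum>a\<in>A. ?pr {C. occurs_at C a b})"
    using \<open>finite A\<close> by (intro measure_pmf.finite_measure_subadditive_finite) auto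
  also have "\<dots> = (\<Sum>a\<in>A. (1 - p) ^ length b * p ^ sum_list b)"
    using p by (intro sum.cong refl prob_occurs_at) (auto simp: A_def)
  also have "\<dots> = real (card A) * ((1 - p) ^ length b * p ^ sum_list b)" by simp
  also have "\<dots> \<le> real n * ((1 - p) ^ length b * p ^ sum_list b)"
  proof -
    have "card A \<le> card {1..n}" unfolding A_def by (intro card_mono) auto
    then show ?thesis using p by (intro mult_right_mono) auto
  qed
  finally show ?thesis .
qed

text \<open>
  Every block gets windows of the same length \<open>l\<close> and uses only their first positions. This makes
  the windows disjoint for all blocks at once and gives one failure bound for all segments.
\<close>

lemma prob_not_contains_le:
  assumes p: "0 \<le> p" "p < 1"
    and blocks: "\<And>b. b \<in> set \<pi> \<Longrightarrow> length b \<le> l \<and> sum_list b \<le> s"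
    and fit: "length \<pi> * N * l \<le> n"
  shows "measure_pmf.prob (geometric_random_composition n p) {C. \<not> contains n C \<pi>}
    \<le> real (length \<pi>) * (1 - (1 - p) ^ l * p ^ s) ^ N"
proof -
  let ?pr = "measure_pmf.prob (geometric_random_composition n p)"
  \<comment> \<open>Window \<open>t\<close> of segment \<open>j\<close> is window \<open>j * N + t\<close> overall; positions are counted from 1.\<close>
  define a where "a = (\<lambda>j t. (j * N + t) * l + 1)"
  define F where "F = (\<lambda>j. {C. \<forall>t<N. \<not> occurs_at C (a j t) (\<pi> ! j)})"
  have window: "a j t + length (\<pi> ! j) \<le> Suc j * N * l + 1" if "j < length \<pi>" "t < N" for j t
  proof -
    have "(j * N + t) * l + l = (j * N + Suc t) * l" by simp
    also have "\<dots> \<le> (Suc j * N) * l" using that by (intro mult_right_mono) auto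
    finally show ?thesis using blocks[of "\<pi> ! j"] that by (simp add: a_def)
  qed
  have "{C. \<not> contains n C \<pi>} \<subseteq> (\<Union>j<length \<pi>. F j)"
  proof (rule subsetI, rule ccontr)
    fix C assume notC: "C \<in> {C. \<not> contains n C \<pi>}" and "C \<notin> (\<Union>j<length \<pi>. F j)"
    then have "\<forall>j<length \<pi>. \<exists>t<N. occurs_at C (a j t) (\<pi> ! j)" by (auto simp: F_def)
    then obtain t where t: "\<And>j. j < length \<pi> \<Longrightarrow> t j < N \<and> occurs_at C (a j (t j)) (\<pi> ! j)"
      by metis
    have "contains (length \<pi> * N * l) C \<pi>"
    proof (rule contains_if_occurs_in_segments[where a = "\<lambda>j. a j (t j)" and e = "\<lambda>j. j * N * l"])
      fix j assume j: "j < length \<pi>"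
      then show "occurs_at C (a j (t j)) (\<pi> ! j) \<and> j * N * l < a j (t j) \<and>
          a j (t j) + length (\<pi> ! j) \<le> Suc j * N * l + 1"
        using t[OF j] window[OF j] by (simp add: a_def add_mult_distrib)
    qed
    then show False using contains_mono[OF _ fit] notC by simp
  qed
  then have "?pr {C. \<not> contains n C \<pi>} \<le> ?pr (\<Union>j<length \<pi>. F j)"
    by (intro measure_pmf.finite_measure_mono) auto
  also have "\<dots> \<le> (\<Sum>j<length \<pi>. ?pr (F j))"
    by (intro measure_pmf.finite_measure_subadditive_finite) auto
  also have "\<dots> \<le> (\<Sum>j<length \<pi>. (1 - (1 - p) ^ l * p ^ s) ^ N)"
  proof (rule sum_mono)
    fix j assume "j \<in> {..<length \<pi>}"
    then have j: "j < length \<pi>" by simp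
    let ?b = "\<pi> ! j"
    have b: "length ?b \<le> l" "sum_list ?b \<le> s" using blocks[of ?b] j by auto
    have "?pr (F j) = (1 - (1 - p) ^ length ?b * p ^ sum_list ?b) ^ N"
      unfolding F_def
    proof (rule prob_no_occurs_at[OF p])
      fix t assume "t < N"
      have "Suc j * N * l \<le> length \<pi> * N * l" using j by (intro mult_right_mono) auto
      then have "a j t + length ?b \<le> n + 1" using window[OF j \<open>t < N\<close>] fit by linarith
      moreover have "1 \<le> a j t" by (simp add: a_def)
      ultimately show "{a j t..<a j t + length ?b} \<subseteq> {1..n}" by auto
    next
      have less: "a j t + length ?b \<le> a j t'" if "t < t'" for t t'
      proof -
        have "(j * N + Suc t) * l \<le> (j * N + t') * l" using that by (intro mult_right_mono) auto
        then show ?thesis using b by (simp add: a_def)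
      qed
      show "disjoint_family_on (\<lambda>t. {a j t..<a j t + length ?b}) {..<N}"
        unfolding disjoint_family_on_def
      proof (intro ballI impI)
        fix t t' :: nat assume "t \<noteq> t'"
        then show "{a j t..<a j t + length ?b} \<inter> {a j t'..<a j t' + length ?b} = {}"
          using less[of t t'] less[of t' t] by (cases t t' rule: linorder_cases) auto
      qed
    qed
    also have "\<dots> \<le> (1 - (1 - p) ^ l * p ^ s) ^ N"
      using p b by (intro power_mono diff_left_mono mult_mono power_decreasing)
        (auto intro!: mult_le_one power_le_one)
    finally show "?pr (F j) \<le> (1 - (1 - p) ^ l * p ^ s) ^ N" .
  qed
  finally show ?thesis by simp
qed

section \<open>Asymptotics\<close>

lemma root_powr_power:
  assumes "0 < n" "0 < k" shows "(real n powr (- 1 / real k)) ^ k = 1 / real n"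
proof -
  have "(real n powr (- 1 / real k)) ^ k = real n powr (real k * (- 1 / real k))"
    using assms by (simp add: powr_power)
  then show ?thesis using assms by (simp add: powr_minus_divide)
qed

lemma much_less_root_imp:
  assumes "much_less f (\<lambda>n. real n powr (- 1 / real k))" and "0 < k"
  shows "(\<lambda>n. real n * f n ^ k) \<longlonglongrightarrow> 0"
proof -
  have "(\<lambda>n. (f n / real n powr (- 1 / real k)) ^ k) \<longlonglongrightarrow> 0 ^ k"
    using assms(1) unfolding much_less_def by (intro tendsto_power) simp
  moreover have "\<forall>\<^sub>F n in sequentially. (f n / real n powr (- 1 / real k)) ^ k = real n * f n ^ k"
    using eventually_gt_at_top[of 0]
    by eventually_elim (simp add: power_divide root_powr_power[OF _ assms(2), simplified])
  ultimately have "(\<lambda>n. real n * f n ^ k) \<longlonglongrightarrow> 0 ^ k" by (rule Lim_transform_eventually)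
  then show ?thesis using assms(2) by (simp add: zero_power)
qed

lemma root_much_less_imp:
  assumes "much_less (\<lambda>n. real n powr (- 1 / real k)) f" and "0 < k"
  shows "(\<lambda>n. 1 / (real n * f n ^ k)) \<longlonglongrightarrow> 0"
proof -
  have "(\<lambda>n. (real n powr (- 1 / real k) / f n) ^ k) \<longlonglongrightarrow> 0 ^ k"
    using assms(1) unfolding much_less_def by (intro tendsto_power) simp
  moreover have "\<forall>\<^sub>F n in sequentially.
      (real n powr (- 1 / real k) / f n) ^ k = 1 / (real n * f n ^ k)"
    using eventually_gt_at_top[of 0]
    by eventually_elim (simp add: power_divide root_powr_power[OF _ assms(2), simplified])
  ultimately have "(\<lambda>n. 1 / (real n * f n ^ k)) \<longlonglongrightarrow> 0 ^ k" by (rule Lim_transform_eventually)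
  then show ?thesis using assms(2) by (simp add: zero_power)
qed

text \<open>
  The bounds are on the reciprocal: if \<open>p \<le> 1/2\<close>, the factor \<open>(1 - p)\<^sup>l\<close> is at least \<open>2\<close> to the
  power \<open>-l\<close>, and if \<open>p > 1/2\<close>, the factor \<open>p\<^sup>s\<close> is at least \<open>2\<close> to the power \<open>-s\<close>. In either
  case one summand of \<open>?u\<close> bounds the reciprocal, so the sum does for every \<open>n\<close>, however
  \<open>p n\<close> moves between the two ranges.
\<close>

lemma expected_occurrences_at_top:
  fixes p :: "nat \<Rightarrow> real"
  assumes p: "\<And>n. 0 \<le> p n \<and> p n < 1" and "0 < s" "0 < l"
    and ps: "much_less (\<lambda>n. real n powr (- 1 / real s)) p"
    and ql: "much_less (\<lambda>n. real n powr (- 1 / real l)) (\<lambda>n. 1 - p n)"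
  shows "filterlim (\<lambda>n. real n * ((1 - p n) ^ l * p n ^ s)) at_top sequentially"
proof -
  let ?x = "\<lambda>n. real n * ((1 - p n) ^ l * p n ^ s)"
  let ?u = "\<lambda>n. 2 ^ l * (1 / (real n * p n ^ s)) + 2 ^ s * (1 / (real n * (1 - p n) ^ l))"
  have pos: "\<forall>\<^sub>F n in sequentially. 0 < n \<and> 0 < p n"
    using ps eventually_gt_at_top[of "0 :: nat"] unfolding much_less_def by (auto intro: eventually_conj)
  have "?u \<longlonglongrightarrow> 2 ^ l * 0 + 2 ^ s * 0"
    by (intro tendsto_intros root_much_less_imp[OF ps \<open>0 < s\<close>] root_much_less_imp[OF ql \<open>0 < l\<close>])
  then have u: "?u \<longlonglongrightarrow> 0" by simp
  have upper: "\<forall>\<^sub>F n in sequentially. inverse (?x n) \<le> ?u n"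
    using pos
  proof eventually_elim
    case (elim n)
    have q: "0 < 1 - p n" using p[of n] by simp
    have *: "0 \<le> 2 ^ l * (1 / (real n * p n ^ s))" "0 \<le> 2 ^ s * (1 / (real n * (1 - p n) ^ l))"
      using elim q by auto
    show ?case
    proof (cases "p n \<le> 1 / 2")
      case True
      have "inverse (1 - p n) ^ l \<le> 2 ^ l"
        using True q by (intro power_mono) (auto simp: field_simps)
      then have "inverse (1 - p n) ^ l * (1 / (real n * p n ^ s)) \<le> 2 ^ l * (1 / (real n * p n ^ s))"
        using elim by (intro mult_right_mono) auto
      then have "inverse (?x n) \<le> 2 ^ l * (1 / (real n * p n ^ s))"
        by (simp add: field_simps)
      then show ?thesis using * by linarith
    next
      case False
      have "inverse (p n) ^ s \<le> 2 ^ s"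
        using False elim by (intro power_mono) (auto simp: field_simps)
      then have "inverse (p n) ^ s * (1 / (real n * (1 - p n) ^ l))
          \<le> 2 ^ s * (1 / (real n * (1 - p n) ^ l))"
        using elim q by (intro mult_right_mono) auto
      then have "inverse (?x n) \<le> 2 ^ s * (1 / (real n * (1 - p n) ^ l))"
        by (simp add: field_simps)
      then show ?thesis using * by linarith
    qed
  qed
  have x_pos: "\<forall>\<^sub>F n in sequentially. 0 < ?x n"
    using pos by eventually_elim (use p in \<open>simp add: less_diff_eq\<close>)
  then have lower: "\<forall>\<^sub>F n in sequentially. 0 \<le> inverse (?x n)"
    by eventually_elim (simp del: inverse_mult_distrib)
  have "(\<lambda>n. inverse (?x n)) \<longlonglongrightarrow> 0"
    by (rule tendsto_sandwich[OF lower upper tendsto_const u])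
  then have "filterlim (\<lambda>n. inverse (inverse (?x n))) at_top sequentially"
    by (rule filterlim_inverse_at_top) (use x_pos in \<open>eventually_elim, simp del: inverse_mult_distrib\<close>)
  then show ?thesis by simp
qed

text \<open>
  Since \<open>1 - r \<le> exp (- r)\<close>, only the rounding of \<open>n / k\<close> is left: it lowers the exponent by less
  than one, which costs at most a factor \<open>exp r\<close>, and \<open>r \<le> 1\<close>.
\<close>

lemma power_div_le_exp:
  fixes r :: real
  assumes "0 \<le> r" "r \<le> 1" "0 < k"
  shows "(1 - r) ^ (n div k) \<le> exp (1 - real n * r / real k)"
proof -
  have "1 - r \<le> exp (- r)" using exp_ge_add_one_self[of "- r"] by simp
  then have "(1 - r) ^ (n div k) \<le> exp (- r) ^ (n div k)" using assms by (intro power_mono) auto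
  also have "\<dots> = exp (- (real (n div k) * r))" using exp_of_nat_mult[of "n div k" "- r"] by simp
  also have "\<dots> \<le> exp (1 - real n * r / real k)"
  proof -
    have "real n / real k - 1 \<le> real (n div k)"
    proof -
      have "n < k * (n div k) + k" using dividend_less_times_div[OF assms(3), of n] by simp
      then have "real n < real k * real (n div k) + real k"
        by (metis of_nat_add of_nat_less_iff of_nat_mult)
      then show ?thesis using assms(3) by (simp add: field_simps)
    qed
    then have "(real n / real k - 1) * r \<le> real (n div k) * r" using assms by (intro mult_right_mono)
    moreover have "(real n / real k - 1) * r = real n * r / real k - r" by (simp add: field_simps)
    ultimately have "- (real (n div k) * r) \<le> 1 - real n * r / real k" using assms by linarith
    then show ?thesis by simp
  qed
  finally show ?thesis .
qed

section \<open>The threshold theorem\<close>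

theorem proposition4p25:
  fixes \<pi> :: vincular_pattern and p q :: "nat \<Rightarrow> real" and s l :: nat
  assumes "exact_vincular_pattern \<pi>" and "nonzero_pattern \<pi>"
    and "s = largest_block_size \<pi>" and "l = longest_block_length \<pi>"
    and "\<And>n. 0 \<le> p n \<and> p n < 1" and "\<And>n. q n = 1 - p n"
  defines "P \<equiv> \<lambda>n. measure_pmf.prob (geometric_random_composition n (p n)) {C. contains n C \<pi>}"
  shows "(much_less p (\<lambda>n. real n powr (- 1 / real s)) \<longrightarrow> P \<longlonglongrightarrow> 0) \<and>
         (much_less (\<lambda>n. real n powr (- 1 / real s)) p \<and>
          much_less (\<lambda>n. real n powr (- 1 / real l)) q \<longrightarrow> P \<longlonglongrightarrow> 1) \<and>
         (much_less q (\<lambda>n. real n powr (- 1 / real l)) \<longrightarrow> P \<longlonglongrightarrow> 0)"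
proof -
  have p: "0 \<le> p n" "p n < 1" for n using assms(5) by auto
  have q: "q = (\<lambda>n. 1 - p n)" using assms(6) by auto
  have ne: "b \<noteq> []" if "b \<in> set \<pi>" for b
    using that assms(1) by (auto simp: exact_vincular_pattern_def)
  obtain r b where r: "b \<in> set \<pi>" "r \<in> set b" "0 < r"
    using assms(2) by (auto simp: nonzero_pattern_def)
  have "set \<pi> \<noteq> {}" using r by auto
  have s_ge: "sum_list b \<le> s" and l_ge: "length b \<le> l" if "b \<in> set \<pi>" for b
    using that by (auto simp: assms(3,4) largest_block_size_def longest_block_length_def)
  have "0 < s" using s_ge[OF r(1)] member_le_sum_list[OF r(2)] r(3) by linarith
  have "0 < l" using l_ge[OF r(1)] ne[OF r(1)] by (cases b) auto
  have "Max (sum_list ` set \<pi>) \<in> sum_list ` set \<pi>" "Max (length ` set \<pi>) \<in> length ` set \<pi>"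
    using \<open>set \<pi> \<noteq> {}\<close> by (auto intro!: Max_in)
  then obtain bs bl where bs: "bs \<in> set \<pi>" "sum_list bs = s" and bl: "bl \<in> set \<pi>" "length bl = l"
    by (auto simp: assms(3,4) largest_block_size_def longest_block_length_def)
  have "P \<longlonglongrightarrow> 0" if "much_less p (\<lambda>n. real n powr (- 1 / real s))"
  proof (rule tendsto_sandwich[OF _ _ tendsto_const much_less_root_imp[OF that \<open>0 < s\<close>]])
    have "P n \<le> real n * p n ^ s" for n
    proof -
      have "P n \<le> real n * ((1 - p n) ^ length bs * p n ^ s)"
        using prob_contains_le[OF p bs(1) ne[OF bs(1)]] bs(2) by (simp add: P_def)
      also have "\<dots> \<le> real n * (1 * p n ^ s)"
        using p[of n] by (intro mult_left_mono mult_right_mono power_le_one) auto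
      finally show ?thesis by simp
    qed
    then show "\<forall>\<^sub>F n in sequentially. P n \<le> real n * p n ^ s" by simp
  qed (simp add: P_def)
  moreover have "P \<longlonglongrightarrow> 0" if "much_less q (\<lambda>n. real n powr (- 1 / real l))"
  proof (rule tendsto_sandwich[OF _ _ tendsto_const much_less_root_imp[OF that \<open>0 < l\<close>]])
    have "P n \<le> real n * q n ^ l" for n
    proof -
      have "P n \<le> real n * ((1 - p n) ^ l * p n ^ sum_list bl)"
        using prob_contains_le[OF p bl(1) ne[OF bl(1)]] bl(2) by (simp add: P_def)
      also have "\<dots> \<le> real n * ((1 - p n) ^ l * 1)"
        using p[of n] by (intro mult_left_mono power_le_one) auto
      finally show ?thesis by (simp add: q)
    qed
    then show "\<forall>\<^sub>F n in sequentially. P n \<le> real n * q n ^ l" by simp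
  qed (simp add: P_def)
  moreover have "P \<longlonglongrightarrow> 1"
    if ps: "much_less (\<lambda>n. real n powr (- 1 / real s)) p"
      and ql: "much_less (\<lambda>n. real n powr (- 1 / real l)) q"
  proof -
    \<comment> \<open>With \<open>m\<close> segments and windows of length \<open>l\<close>, there is room for \<open>n div k\<close> windows per
      segment, and \<open>x n\<close> is of the order of the expected number of hits.\<close>
    define m where "m = length \<pi>"
    define k where "k = m * l"
    define x where "x = (\<lambda>n. real n * ((1 - p n) ^ l * p n ^ s))"
    have "0 < k" using \<open>0 < l\<close> r(1) by (auto simp: k_def m_def)
    have lower: "1 - real m * exp (1 - x n / real k) \<le> P n" for n
    proof -
      have "m * (n div k) * l \<le> n"
        using div_times_less_eq_dividend[of n k] by (simp add: k_def ac_simps)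
      then have "measure_pmf.prob (geometric_random_composition n (p n)) {C. \<not> contains n C \<pi>}
          \<le> real m * (1 - (1 - p n) ^ l * p n ^ s) ^ (n div k)"
        unfolding m_def using s_ge l_ge by (intro prob_not_contains_le p) auto
      also have "\<dots> \<le> real m * exp (1 - x n / real k)"
        unfolding x_def using p[of n] \<open>0 < k\<close>
        by (intro mult_left_mono power_div_le_exp mult_le_one power_le_one) auto
      also have "measure_pmf.prob (geometric_random_composition n (p n)) {C. \<not> contains n C \<pi>} = 1 - P n"
        unfolding P_def
        by (subst measure_pmf.prob_compl[symmetric]) (auto simp: Collect_neg_eq Compl_eq_Diff_UNIV)
      finally show ?thesis by linarith
    qed
    have "filterlim x at_top sequentially"
      unfolding x_def using ps ql assms(5) \<open>0 < s\<close> \<open>0 < l\<close>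
      by (intro expected_occurrences_at_top) (auto simp: q)
    then have "filterlim (\<lambda>n. 1 / real k * x n) at_top sequentially"
      using \<open>0 < k\<close> by (intro filterlim_tendsto_pos_mult_at_top[OF tendsto_const]) auto
    then have "(\<lambda>n. exp (- (1 / real k * x n))) \<longlonglongrightarrow> 0"
      by (intro filterlim_compose[OF exp_at_bot]) (simp add: filterlim_uminus_at_bot)
    then have "(\<lambda>n. 1 - real m * (exp 1 * exp (- (1 / real k * x n)))) \<longlonglongrightarrow> 1 - real m * (exp 1 * 0)"
      by (intro tendsto_intros)
    then have lim: "(\<lambda>n. 1 - real m * exp (1 - x n / real k)) \<longlonglongrightarrow> 1"
      by (simp add: exp_diff exp_minus field_simps)
    show ?thesis
      by (rule tendsto_sandwich[OF _ _ lim tendsto_const]) (use lower in \<open>auto simp: P_def\<close>)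
  qed
  ultimately show ?thesis by blast
qed

end
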